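(* If a sequent $\Gamma[\Delta]\Rightarrow\beta$ is derivable in $\mathsf{GwIK}_t^\ddagger$, then $\Gamma[\Delta]\Rightarrow\beta$ is derivable in $\mathsf{GwIK}_t^\ddagger$ without any applications of $(\mathrm{Mix_A})$, $(\mathrm{Mix}_\sharp)$, $(\mathrm{Mix}_\to)$ and $(\mathrm{Cut}_\ast)$.
   Context: Formulas: the set $\mathcal{F}$ is generated by $\alpha ::= p \mid \top \mid \bot \mid (\alpha_1\to\alpha_2)\mid(\alpha_1\wedge\alpha_2)\mid(\alpha_1\vee\alpha_2)\mid\Diamond\alpha\mid\Box\alpha\mid\mathsf{P}\alpha\mid\blacksquare\alpha$, with $p$ from a denumerable set $\mathbf{Var}$ of variables; $\Diamond,\Box,\mathsf{P},\blacksquare$ are four unary (tense) connectives; $\mathbf{Atom}=\mathbf{Var}\cup\{\bot,\top\}$. Structures: the set $\mathcal{FS}$ of formula structures is generated by $\Gamma ::= \alpha\mid(\Gamma_1,\Gamma_2)\mid\circ\Gamma\mid\bullet\Gamma$ with $\alpha\in\mathcal{F}$ (the comma is a binary structure operator, $\circ$ and $\bullet$ are unary ones); $\mathcal{FS}^\epsilon=\mathcal{FS}\cup\{\epsilon\}$ where $\epsilon$ is the empty structure. A sequent is an expression $\Gamma\Rightarrow\beta$ with $\Gamma\in\mathcal{FS}^\epsilon$, $\beta\in\mathcal{F}$. Contexts: $\Gamma[-] ::= -\mid(\Gamma_1[-],\Gamma_2)\mid(\Gamma_1,\Gamma_2[-])\mid\circ\Gamma[-]\mid\bullet\Gamma[-]$,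 where the side components are formula structures; $\Gamma[\Delta]$ is the structure obtained by putting $\Delta\in\mathcal{FS}$ in the position $-$. For $n\ge 1$, $\Gamma[\alpha]^n$ denotes a structure with $n$ designated occurrences of $\alpha$, and $\Gamma[\Delta]^n$ the result of replacing these $n$ occurrences by $\Delta$. In rule $({\to}\mathrm{R})$ below, when $\Gamma=\epsilon$ the expression $\beta_1,\Gamma$ is read as $\beta_1$. The calculus $\mathsf{GwIK}_t^\ddagger$ has the following axioms and rules (written "premises / conclusion", $i\in\{1,2\}$). Axiom: $(\mathrm{Id_A})$ $x\Rightarrow x$ for $x\in\mathbf{Atom}$. Logical rules: $(\top)$ $\Gamma[\top]\Rightarrow\beta$ / $\Gamma[\Delta]\Rightarrow\beta$; $(\bot)$ $\Delta\Rightarrow\bot$ / $\Gamma[\Delta]\Rightarrow\beta$; $({\wedge}\mathrm{L})$ $\Gamma[\alpha_1,\alpha_2]\Rightarrow\beta$ / $\Gamma[\alpha_1\wedge\alpha_2]\Rightarrow\beta$; $({\wedge}\mathrm{R})$ $\Gamma\Rightarrow\beta_1$ and $\Gamma\Rightarrow\beta_2$ / $\Gamma\Rightarrow\beta_1\wedge\beta_2$; $({\vee}\mathrm{L})$ $\Gamma[\alpha_1]\Rightarrow\beta$ and $\Gamma[\alpha_2]\Rightarrow\beta$ / $\Gamma[\alpha_1\vee\alpha_2]\Rightarrow\beta$; $({\vee}\mathrm{R})$ $\Gamma\Rightarrow\beta_i$ / $\Gamma\Rightarrow\beta_1\vee\beta_2$; $({\to}\mathrm{L})$ $\Delta\Rightarrow\alpha_1$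 and $\Gamma[\alpha_2]\Rightarrow\beta$ / $\Gamma[\Delta,\alpha_1\to\alpha_2]\Rightarrow\beta$; $({\to}\mathrm{R})$ $\beta_1,\Gamma\Rightarrow\beta_2$ / $\Gamma\Rightarrow\beta_1\to\beta_2$. Tense rules: $(\Diamond\mathrm{L})$ $\Gamma[\circ\alpha]\Rightarrow\beta$ / $\Gamma[\Diamond\alpha]\Rightarrow\beta$; $(\Diamond\mathrm{R})$ $\Gamma\Rightarrow\beta$ / $\circ\Gamma\Rightarrow\Diamond\beta$; $(\mathsf{P}\mathrm{L})$ $\Gamma[\bullet\alpha]\Rightarrow\beta$ / $\Gamma[\mathsf{P}\alpha]\Rightarrow\beta$; $(\mathsf{P}\mathrm{R})$ $\Gamma\Rightarrow\beta$ / $\bullet\Gamma\Rightarrow\mathsf{P}\beta$; $(\blacksquare\mathrm{L})$ $\Gamma[\alpha]\Rightarrow\beta$ / $\Gamma[\circ\blacksquare\alpha]\Rightarrow\beta$; $(\blacksquare\mathrm{R})$ $\circ\Gamma\Rightarrow\beta$ / $\Gamma\Rightarrow\blacksquare\beta$; $(\Box\mathrm{L})$ $\Gamma[\alpha]\Rightarrow\beta$ / $\Gamma[\bullet\Box\alpha]\Rightarrow\beta$; $(\Box\mathrm{R})$ $\bullet\Gamma\Rightarrow\beta$ / $\Gamma\Rightarrow\Box\beta$. Structural rules: $(\mathrm{Con}_\circ)$ $\Gamma[\circ\Delta_1,\circ\Delta_2]\Rightarrow\beta$ / $\Gamma[\circ(\Delta_1,\Delta_2)]\Rightarrow\beta$;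 $(\mathrm{Con}_\bullet)$ $\Gamma[\bullet\Delta_1,\bullet\Delta_2]\Rightarrow\beta$ / $\Gamma[\bullet(\Delta_1,\Delta_2)]\Rightarrow\beta$; $(\mathrm{Con_A})$ $\Gamma[x,x]\Rightarrow\beta$ / $\Gamma[x]\Rightarrow\beta$ for $x\in\mathbf{Atom}$; $(\mathrm{Con}_\sharp)$ $\Gamma[\sharp\alpha,\sharp\alpha]\Rightarrow\beta$ / $\Gamma[\sharp\alpha]\Rightarrow\beta$ for $\sharp\in\{\Box,\blacksquare\}$; $(\mathrm{Con}_\to)$ $\Gamma[\alpha_1\to\alpha_2,\alpha_1\to\alpha_2]\Rightarrow\beta$ / $\Gamma[\alpha_1\to\alpha_2]\Rightarrow\beta$; $(\mathrm{Wk})$ $\Gamma[\Delta_i]\Rightarrow\beta$ / $\Gamma[\Delta_1,\Delta_2]\Rightarrow\beta$; $(\mathrm{Ex})$ $\Gamma[\Delta_1,\Delta_2]\Rightarrow\beta$ / $\Gamma[\Delta_2,\Delta_1]\Rightarrow\beta$; $(\mathrm{Dual}_{\circ\bullet})$ $\circ\Delta_1,\Delta_2\Rightarrow\bot$ / $\Gamma[\Delta_1,\bullet\Delta_2]\Rightarrow\beta$; $(\mathrm{Dual}_{\bullet\circ})$ $\bullet\Delta_1,\Delta_2\Rightarrow\bot$ / $\Gamma[\Delta_1,\circ\Delta_2]\Rightarrow\beta$. (Cut)-like rules: $(\mathrm{Mix_A})$ $\Delta\Rightarrow x$ and $\Gamma[x]^n\Rightarrow\beta$ / $\Gamma[\Delta]^n\Rightarrow\beta$,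 for $x\in\mathbf{Atom}$; $(\mathrm{Mix}_\sharp)$ $\Delta\Rightarrow\sharp\alpha$ and $\Gamma[\sharp\alpha]^n\Rightarrow\beta$ / $\Gamma[\Delta]^n\Rightarrow\beta$, for $\sharp\in\{\Box,\blacksquare\}$; $(\mathrm{Mix}_\to)$ $\Delta\Rightarrow\alpha_1\to\alpha_2$ and $\Gamma[\alpha_1\to\alpha_2]^n\Rightarrow\beta$ / $\Gamma[\Delta]^n\Rightarrow\beta$; $(\mathrm{Cut}_\ast)$ $\Delta\Rightarrow\alpha^\ast$ and $\Gamma[\alpha^\ast]\Rightarrow\beta$ / $\Gamma[\Delta]\Rightarrow\beta$, where $\alpha^\ast$ is neither atomic nor of the form $\Box\alpha$, $\blacksquare\alpha$ or $\alpha_1\to\alpha_2$.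
   Formalization: The comma is taken to be associative: two rules regrouping commas are added to the calculus. They are already derivable using Cut_*, but without them the claim fails, e.g. p, p→(p→q) ⇒ q has a derivation with Cut_* but none free of Mix and Cut rules. *)

theory Defs
  imports Main
begin

datatype fml =
    Var nat
  | Top
  | Bot
  | Imp fml fml  (infixr "\<rightarrow>\<^sub>f" 55)
  | And fml fml  (infixr "\<and>\<^sub>f" 65)
  | Or fml fml  (infixr "\<or>\<^sub>f" 60)
  | Dia fml
  | Box fml
  | Pst fml
  | BBox fml

definition Atom :: "fml set" where
  "Atom = range Var \<union> {Bot, Top}"

datatype fstruct =
    Fm fml
  | Comma fstruct fstruct  (infixr ";;" 65)
  | Circ fstruct
  | Bullet fstruct

(* A sequent has an antecedent of type "fstruct option"; None is the empty structure.
   Since the grammar does not apply Comma, Circ or Bullet to the empty structure, it occurs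
   only as an entire antecedent. *)

datatype ctx =
    Hole
  | CommaL ctx fstruct
  | CommaR fstruct ctx
  | CircC ctx
  | BulletC ctx

primrec fill :: "ctx \<Rightarrow> fstruct \<Rightarrow> fstruct"  ("_\<langle>_\<rangle>" [1000, 0] 1000) where
  "fill Hole D = D"
| "fill (CommaL G S) D = (fill G D ;; S)"
| "fill (CommaR S G) D = (S ;; fill G D)"
| "fill (CircC G) D = Circ (fill G D)"
| "fill (BulletC G) D = Bullet (fill G D)"

(* Structures with any number of holes. With n = holes G, the structure mfill G (Fm a) has
   n designated occurrences of a, and mfill G D replaces exactly these by D; further,
   undesignated occurrences of a may be present as MFm a. *)

datatype mctx =
    MHole
  | MFm fml
  | MComma mctx mctx
  | MCirc mctx
  | MBullet mctx

primrec holes :: "mctx \<Rightarrow> nat" where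
  "holes MHole = 1"
| "holes (MFm a) = 0"
| "holes (MComma G H) = holes G + holes H"
| "holes (MCirc G) = holes G"
| "holes (MBullet G) = holes G"

primrec mfill :: "mctx \<Rightarrow> fstruct \<Rightarrow> fstruct" where
  "mfill MHole D = D"
| "mfill (MFm a) D = Fm a"
| "mfill (MComma G H) D = (mfill G D ;; mfill H D)"
| "mfill (MCirc G) D = Circ (mfill G D)"
| "mfill (MBullet G) D = Bullet (mfill G D)"

fun comma_ante :: "fml \<Rightarrow> fstruct option \<Rightarrow> fstruct" where
  "comma_ante b None = Fm b"
| "comma_ante b (Some S) = (Fm b ;; S)"

definition cut_star_fml :: "fml \<Rightarrow> bool" where
  "cut_star_fml a \<longleftrightarrow>
     a \<notin> Atom \<and> (\<forall>c. a \<noteq> Box c) \<and> (\<forall>c. a \<noteq> BBox c) \<and> (\<forall>c d. a \<noteq> (c \<rightarrow>\<^sub>f d))"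

datatype cut_rule = MixA | MixSharp | MixImp | CutStar

(* "gwikt R S b" is derivability of the sequent S \<Rightarrow> b when, of the four cut-like rules, only
   those in R may be applied. All other rules are always available: R = UNIV is the full
   calculus, R = {} the calculus without cut-like rules.

   The comma is associative: structures that differ only in the bracketing of commas are
   identified. Since Comma is a free constructor, the rules AssocL and AssocR carry
   this out. They add no sequent to the full calculus, where they are obtained from CutStar.
   For R = {} they cannot be dropped: with distinct variables p and q,
   p, p \<rightarrow> (p \<rightarrow> q) \<Rightarrow> q is derivable with CutStar, but if commas are not regrouped it has
   no derivation free of cut-like rules. *)

inductive gwikt :: "cut_rule set \<Rightarrow> fstruct option \<Rightarrow> fml \<Rightarrow> bool" for R where
  IdA: "x \<in> Atom \<Longrightarrow> gwikt R (Some (Fm x)) x"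

| TopRule: "gwikt R (Some (G\<langle>Fm Top\<rangle>)) b \<Longrightarrow> gwikt R (Some (G\<langle>D\<rangle>)) b"
| BotRule: "gwikt R (Some D) Bot \<Longrightarrow> gwikt R (Some (G\<langle>D\<rangle>)) b"
| AndL: "gwikt R (Some (G\<langle>Fm a1 ;; Fm a2\<rangle>)) b \<Longrightarrow> gwikt R (Some (G\<langle>Fm (a1 \<and>\<^sub>f a2)\<rangle>)) b"
| AndR: "gwikt R S b1 \<Longrightarrow> gwikt R S b2 \<Longrightarrow> gwikt R S (b1 \<and>\<^sub>f b2)"
| OrL: "gwikt R (Some (G\<langle>Fm a1\<rangle>)) b \<Longrightarrow> gwikt R (Some (G\<langle>Fm a2\<rangle>)) b
    \<Longrightarrow> gwikt R (Some (G\<langle>Fm (a1 \<or>\<^sub>f a2)\<rangle>)) b"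
| OrR1: "gwikt R S b1 \<Longrightarrow> gwikt R S (b1 \<or>\<^sub>f b2)"
| OrR2: "gwikt R S b2 \<Longrightarrow> gwikt R S (b1 \<or>\<^sub>f b2)"
| ImpL: "gwikt R (Some D) a1 \<Longrightarrow> gwikt R (Some (G\<langle>Fm a2\<rangle>)) b
    \<Longrightarrow> gwikt R (Some (G\<langle>D ;; Fm (a1 \<rightarrow>\<^sub>f a2)\<rangle>)) b"
| ImpR: "gwikt R (Some (comma_ante b1 S)) b2 \<Longrightarrow> gwikt R S (b1 \<rightarrow>\<^sub>f b2)"

| DiaL: "gwikt R (Some (G\<langle>Circ (Fm a)\<rangle>)) b \<Longrightarrow> gwikt R (Some (G\<langle>Fm (Dia a)\<rangle>)) b"
| DiaR: "gwikt R (Some S) b \<Longrightarrow> gwikt R (Some (Circ S)) (Dia b)"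
| PstL: "gwikt R (Some (G\<langle>Bullet (Fm a)\<rangle>)) b \<Longrightarrow> gwikt R (Some (G\<langle>Fm (Pst a)\<rangle>)) b"
| PstR: "gwikt R (Some S) b \<Longrightarrow> gwikt R (Some (Bullet S)) (Pst b)"
| BBoxL: "gwikt R (Some (G\<langle>Fm a\<rangle>)) b \<Longrightarrow> gwikt R (Some (G\<langle>Circ (Fm (BBox a))\<rangle>)) b"
| BBoxR: "gwikt R (Some (Circ S)) b \<Longrightarrow> gwikt R (Some S) (BBox b)"
| BoxL: "gwikt R (Some (G\<langle>Fm a\<rangle>)) b \<Longrightarrow> gwikt R (Some (G\<langle>Bullet (Fm (Box a))\<rangle>)) b"
| BoxR: "gwikt R (Some (Bullet S)) b \<Longrightarrow> gwikt R (Some S) (Box b)"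

| ConCirc: "gwikt R (Some (G\<langle>Circ D1 ;; Circ D2\<rangle>)) b \<Longrightarrow> gwikt R (Some (G\<langle>Circ (D1 ;; D2)\<rangle>)) b"
| ConBullet: "gwikt R (Some (G\<langle>Bullet D1 ;; Bullet D2\<rangle>)) b
    \<Longrightarrow> gwikt R (Some (G\<langle>Bullet (D1 ;; D2)\<rangle>)) b"
| ConA: "x \<in> Atom \<Longrightarrow> gwikt R (Some (G\<langle>Fm x ;; Fm x\<rangle>)) b \<Longrightarrow> gwikt R (Some (G\<langle>Fm x\<rangle>)) b"
| ConSharp: "sharp \<in> {Box, BBox} \<Longrightarrow> gwikt R (Some (G\<langle>Fm (sharp a) ;; Fm (sharp a)\<rangle>)) b
    \<Longrightarrow> gwikt R (Some (G\<langle>Fm (sharp a)\<rangle>)) b"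
| ConImp: "gwikt R (Some (G\<langle>Fm (a1 \<rightarrow>\<^sub>f a2) ;; Fm (a1 \<rightarrow>\<^sub>f a2)\<rangle>)) b
    \<Longrightarrow> gwikt R (Some (G\<langle>Fm (a1 \<rightarrow>\<^sub>f a2)\<rangle>)) b"
| Wk1: "gwikt R (Some (G\<langle>D1\<rangle>)) b \<Longrightarrow> gwikt R (Some (G\<langle>D1 ;; D2\<rangle>)) b"
| Wk2: "gwikt R (Some (G\<langle>D2\<rangle>)) b \<Longrightarrow> gwikt R (Some (G\<langle>D1 ;; D2\<rangle>)) b"
| Ex: "gwikt R (Some (G\<langle>D1 ;; D2\<rangle>)) b \<Longrightarrow> gwikt R (Some (G\<langle>D2 ;; D1\<rangle>)) b"
| DualCircBullet: "gwikt R (Some (Circ D1 ;; D2)) Bot \<Longrightarrow> gwikt R (Some (G\<langle>D1 ;; Bullet D2\<rangle>)) b"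
| DualBulletCirc: "gwikt R (Some (Bullet D1 ;; D2)) Bot \<Longrightarrow> gwikt R (Some (G\<langle>D1 ;; Circ D2\<rangle>)) b"

| AssocL: "gwikt R (Some (G\<langle>D1 ;; (D2 ;; D3)\<rangle>)) b \<Longrightarrow> gwikt R (Some (G\<langle>(D1 ;; D2) ;; D3\<rangle>)) b"
| AssocR: "gwikt R (Some (G\<langle>(D1 ;; D2) ;; D3\<rangle>)) b \<Longrightarrow> gwikt R (Some (G\<langle>D1 ;; (D2 ;; D3)\<rangle>)) b"

| MixA: "MixA \<in> R \<Longrightarrow> x \<in> Atom \<Longrightarrow> holes M \<ge> 1 \<Longrightarrow> gwikt R (Some D) x
    \<Longrightarrow> gwikt R (Some (mfill M (Fm x))) b \<Longrightarrow> gwikt R (Some (mfill M D)) b"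
| MixSharp: "MixSharp \<in> R \<Longrightarrow> sharp \<in> {Box, BBox} \<Longrightarrow> holes M \<ge> 1 \<Longrightarrow> gwikt R (Some D) (sharp a)
    \<Longrightarrow> gwikt R (Some (mfill M (Fm (sharp a)))) b \<Longrightarrow> gwikt R (Some (mfill M D)) b"
| MixImp: "MixImp \<in> R \<Longrightarrow> holes M \<ge> 1 \<Longrightarrow> gwikt R (Some D) (a1 \<rightarrow>\<^sub>f a2)
    \<Longrightarrow> gwikt R (Some (mfill M (Fm (a1 \<rightarrow>\<^sub>f a2)))) b \<Longrightarrow> gwikt R (Some (mfill M D)) b"
| CutStar: "CutStar \<in> R \<Longrightarrow> cut_star_fml a \<Longrightarrow> gwikt R (Some D) a
    \<Longrightarrow> gwikt R (Some (G\<langle>Fm a\<rangle>)) b \<Longrightarrow> gwikt R (Some (G\<langle>D\<rangle>)) b"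

end

theory Submission
  imports Defs
begin

text \<open>Every rule with a cut formula \<open>A\<close> follows from one principle: in a derivation of \<open>S \<Rightarrow> b\<close>, any
  set of leaves \<open>A\<close> of \<open>S\<close> may be replaced by \<open>D\<close>, provided that the left rules principal in \<open>A\<close>
  survive the replacement. For \<open>D\<close> the structural reading of \<open>A\<close> this is inversion of the left
  rules for \<open>\<and>\<close>, \<open>\<or>\<close>, \<open>\<Diamond>\<close> and \<open>P\<close>, which reduces contraction of arbitrary structures to the
  primitive contraction rules. For \<open>D \<Rightarrow> A\<close> derivable the proviso is proved by induction on \<open>A\<close>:
  a dual principle for right rules analyses the derivation of \<open>D \<Rightarrow> A\<close>, and only cuts on immediate
  subformulas of \<open>A\<close> and contraction remain.\<close>

section \<open>Contexts and replacement of formula leaves\<close>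

abbreviation cut_free :: "fstruct \<Rightarrow> fml \<Rightarrow> bool"  (infix "\<turnstile>" 50) where
  "S \<turnstile> b \<equiv> gwikt {} (Some S) b"

primrec ctx_comp :: "ctx \<Rightarrow> ctx \<Rightarrow> ctx"  (infixr "\<cdot>" 75) where
  "Hole \<cdot> H = H"
| "CommaL G S \<cdot> H = CommaL (G \<cdot> H) S"
| "CommaR S G \<cdot> H = CommaR S (G \<cdot> H)"
| "CircC G \<cdot> H = CircC (G \<cdot> H)"
| "BulletC G \<cdot> H = BulletC (G \<cdot> H)"

lemma fill_ctx_comp: "(G \<cdot> H)\<langle>S\<rangle> = G\<langle>H\<langle>S\<rangle>\<rangle>"
  by (induction G) auto

text \<open>\<open>keep\<close> also applies to \<open>A\<close>, so the occurrences to replace can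
  be chosen freely. A single marked position would not survive an induction on derivations, since
  contraction doubles it in the premise. The relation serves ordinary contexts and
  \<open>mctx\<close> alike.\<close>

inductive repl :: "fml \<Rightarrow> fstruct \<Rightarrow> fstruct \<Rightarrow> fstruct \<Rightarrow> bool" for A D where
  keep: "repl A D (Fm c) (Fm c)"
| replace: "repl A D (Fm A) D"
| Comma: "repl A D S S' \<Longrightarrow> repl A D T T' \<Longrightarrow> repl A D (S ;; T) (S' ;; T')"
| Circ: "repl A D S S' \<Longrightarrow> repl A D (Circ S) (Circ S')"
| Bullet: "repl A D S S' \<Longrightarrow> repl A D (Bullet S) (Bullet S')"

inductive_simps repl_simps:
  "repl A D (Fm c) T" "repl A D (S1 ;; S2) T" "repl A D (Circ S) T" "repl A D (Bullet S) T"

lemma repl_refl: "repl A D S S"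
  by (induction S) (auto intro: repl.intros)

lemma repl_fill: "repl A D X Y \<Longrightarrow> repl A D G\<langle>X\<rangle> G\<langle>Y\<rangle>"
  by (induction G) (auto intro: repl.intros repl_refl)

lemma repl_mfill: "repl A D (mfill M (Fm A)) (mfill M D)"
  by (induction M) (auto intro: repl.intros)

text \<open>Replacement only affects leaves, so it never crosses the boundary of the hole: it splits
  into a part in the side structures, giving \<open>G'\<close>, and a part in \<open>X\<close>. The
  last clause carries the same side replacement over to the premise of a rule, where
  \<open>X\<close> gives way to some \<open>Y\<close>.\<close>

lemma repl_fillD:
  "repl A D G\<langle>X\<rangle> T \<Longrightarrow> \<exists>G' X'. T = G'\<langle>X'\<rangle> \<and> repl A D X X' \<and>
     (\<forall>Y Y'. repl A D Y Y' \<longrightarrow> repl A D G\<langle>Y\<rangle> G'\<langle>Y'\<rangle>)"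
proof (induction G arbitrary: T)
  case Hole
  then show ?case by (auto intro!: exI[of _ Hole])
next
  case (CommaL G S)
  then obtain T1 S' where T: "T = (T1 ;; S')" "repl A D G\<langle>X\<rangle> T1" "repl A D S S'"
    by (auto simp: repl_simps)
  from CommaL.IH[OF T(2)] obtain G' X' where "T1 = G'\<langle>X'\<rangle>" "repl A D X X'"
      "\<forall>Y Y'. repl A D Y Y' \<longrightarrow> repl A D G\<langle>Y\<rangle> G'\<langle>Y'\<rangle>" by blast
  then show ?case using T by (intro exI[of _ "CommaL G' S'"] exI[of _ X']) (auto intro: repl.intros)
next
  case (CommaR S G)
  then obtain T1 S' where T: "T = (S' ;; T1)" "repl A D G\<langle>X\<rangle> T1" "repl A D S S'"
    by (auto simp: repl_simps)
  from CommaR.IH[OF T(2)] obtain G' X' where "T1 = G'\<langle>X'\<rangle>" "repl A D X X'"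
      "\<forall>Y Y'. repl A D Y Y' \<longrightarrow> repl A D G\<langle>Y\<rangle> G'\<langle>Y'\<rangle>" by blast
  then show ?case using T by (intro exI[of _ "CommaR S' G'"] exI[of _ X']) (auto intro: repl.intros)
next
  case (CircC G)
  then obtain T1 where T: "T = Circ T1" "repl A D G\<langle>X\<rangle> T1"
    by (auto simp: repl_simps)
  from CircC.IH[OF T(2)] obtain G' X' where "T1 = G'\<langle>X'\<rangle>" "repl A D X X'"
      "\<forall>Y Y'. repl A D Y Y' \<longrightarrow> repl A D G\<langle>Y\<rangle> G'\<langle>Y'\<rangle>" by blast
  then show ?case using T by (intro exI[of _ "CircC G'"] exI[of _ X']) (auto intro: repl.intros)
next
  case (BulletC G)
  then obtain T1 where T: "T = Bullet T1" "repl A D G\<langle>X\<rangle> T1"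
    by (auto simp: repl_simps)
  from BulletC.IH[OF T(2)] obtain G' X' where "T1 = G'\<langle>X'\<rangle>" "repl A D X X'"
      "\<forall>Y Y'. repl A D Y Y' \<longrightarrow> repl A D G\<langle>Y\<rangle> G'\<langle>Y'\<rangle>" by blast
  then show ?case using T by (intro exI[of _ "BulletC G'"] exI[of _ X']) (auto intro: repl.intros)
qed

section \<open>Replacing a formula in the antecedent\<close>

definition contractible :: "fstruct \<Rightarrow> bool" where
  "contractible D \<longleftrightarrow> (\<forall>G b. G\<langle>D ;; D\<rangle> \<turnstile> b \<longrightarrow> G\<langle>D\<rangle> \<turnstile> b)"

text \<open>The left rules whose principal formula is \<open>A\<close> remain admissible when that formula is
  replaced by \<open>D\<close>. Contraction of \<open>D\<close> is required only where the calculus contracts \<open>A\<close>: the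
  remaining cases serve as inversion lemmas in the proof that every structure is contractible.\<close>

primrec left_adm :: "fml \<Rightarrow> fstruct \<Rightarrow> bool" where
  "left_adm (Var n) D \<longleftrightarrow> contractible D \<and> D \<turnstile> Var n"
| "left_adm Top D \<longleftrightarrow> contractible D \<and> D \<turnstile> Top"
| "left_adm Bot D \<longleftrightarrow> contractible D \<and> D \<turnstile> Bot"
| "left_adm (a1 \<rightarrow>\<^sub>f a2) D \<longleftrightarrow> contractible D \<and>
     (\<forall>S G b. S \<turnstile> a1 \<longrightarrow> G\<langle>Fm a2\<rangle> \<turnstile> b \<longrightarrow> G\<langle>S ;; D\<rangle> \<turnstile> b)"
| "left_adm (a1 \<and>\<^sub>f a2) D \<longleftrightarrow> (\<forall>G b. G\<langle>Fm a1 ;; Fm a2\<rangle> \<turnstile> b \<longrightarrow> G\<langle>D\<rangle> \<turnstile> b)"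
| "left_adm (a1 \<or>\<^sub>f a2) D \<longleftrightarrow> (\<forall>G b. G\<langle>Fm a1\<rangle> \<turnstile> b \<longrightarrow> G\<langle>Fm a2\<rangle> \<turnstile> b \<longrightarrow> G\<langle>D\<rangle> \<turnstile> b)"
| "left_adm (Dia a) D \<longleftrightarrow> (\<forall>G b. G\<langle>Circ (Fm a)\<rangle> \<turnstile> b \<longrightarrow> G\<langle>D\<rangle> \<turnstile> b)"
| "left_adm (Box a) D \<longleftrightarrow> contractible D \<and> (\<forall>G b. G\<langle>Fm a\<rangle> \<turnstile> b \<longrightarrow> G\<langle>Bullet D\<rangle> \<turnstile> b)"
| "left_adm (Pst a) D \<longleftrightarrow> (\<forall>G b. G\<langle>Bullet (Fm a)\<rangle> \<turnstile> b \<longrightarrow> G\<langle>D\<rangle> \<turnstile> b)"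
| "left_adm (BBox a) D \<longleftrightarrow> contractible D \<and> (\<forall>G b. G\<langle>Fm a\<rangle> \<turnstile> b \<longrightarrow> G\<langle>Circ D\<rangle> \<turnstile> b)"

lemma left_adm_contractible: "left_adm A D \<Longrightarrow> A \<in> Atom \<Longrightarrow> contractible D"
  and left_adm_Atom: "left_adm A D \<Longrightarrow> A \<in> Atom \<Longrightarrow> D \<turnstile> A"
  by (auto simp: Atom_def)

lemma contractibleD: "contractible D \<Longrightarrow> G\<langle>D ;; D\<rangle> \<turnstile> b \<Longrightarrow> G\<langle>D\<rangle> \<turnstile> b"
  by (auto simp: contractible_def)

text \<open>Induction on the derivation. If the principal formula is kept, the same rule applies to
  the replaced premises; if it is replaced by \<open>D\<close>, the matching clause of
  \<open>left_adm\<close> stands in for the rule. Active formulas in a premise are kept, by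
  \<open>repl_refl\<close>.\<close>

lemma replace_left_adm:
  assumes "S \<turnstile> b" "left_adm A D" "repl A D S T"
  shows "T \<turnstile> b"
  using assms(1,3)
proof (induction "Some S" b arbitrary: S T rule: gwikt.induct)
  case (IdA x)
  then show ?case using assms(2) by (auto simp: repl_simps left_adm_Atom intro: gwikt.IdA)
next
  case (TopRule G b E)
  obtain G' X where T: "T = G'\<langle>X\<rangle>" "repl A D E X"
    and R: "\<And>Y Y'. repl A D Y Y' \<Longrightarrow> repl A D G\<langle>Y\<rangle> G'\<langle>Y'\<rangle>"
    using repl_fillD[OF TopRule.prems] by blast
  from TopRule.hyps(2)[OF R[OF repl_refl]] show ?case
    using T assms(2) by (auto simp: repl_simps intro: gwikt.TopRule)
next
  case (BotRule E G b)
  obtain G' X where T: "T = G'\<langle>X\<rangle>" "repl A D E X"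
    and R: "\<And>Y Y'. repl A D Y Y' \<Longrightarrow> repl A D G\<langle>Y\<rangle> G'\<langle>Y'\<rangle>"
    using repl_fillD[OF BotRule.prems] by blast
  from BotRule.hyps(2)[OF T(2)] show ?case
    unfolding T(1) by (rule gwikt.BotRule)
next
  case (AndL G a1 a2 b)
  obtain G' X where T: "T = G'\<langle>X\<rangle>" "repl A D (Fm (a1 \<and>\<^sub>f a2)) X"
    and R: "\<And>Y Y'. repl A D Y Y' \<Longrightarrow> repl A D G\<langle>Y\<rangle> G'\<langle>Y'\<rangle>"
    using repl_fillD[OF AndL.prems] by blast
  from AndL.hyps(2)[OF R[OF repl_refl]] show ?case
    using T assms(2) by (auto simp: repl_simps intro: gwikt.AndL)
next
  case (AndR b1 b2)
  then show ?case by (auto intro: gwikt.AndR)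
next
  case (OrL G a1 b a2)
  obtain G' X where T: "T = G'\<langle>X\<rangle>" "repl A D (Fm (a1 \<or>\<^sub>f a2)) X"
    and R: "\<And>Y Y'. repl A D Y Y' \<Longrightarrow> repl A D G\<langle>Y\<rangle> G'\<langle>Y'\<rangle>"
    using repl_fillD[OF OrL.prems] by blast
  from OrL.hyps(2)[OF R[OF repl_refl]] OrL.hyps(4)[OF R[OF repl_refl]] show ?case
    using T assms(2) by (auto simp: repl_simps intro: gwikt.OrL)
next
  case (OrR1 b1 b2)
  then show ?case by (auto intro: gwikt.OrR1)
next
  case (OrR2 b2 b1)
  then show ?case by (auto intro: gwikt.OrR2)
next
  case (ImpL E a1 G a2 b)
  obtain G' X where T: "T = G'\<langle>X\<rangle>" "repl A D (E ;; Fm (a1 \<rightarrow>\<^sub>f a2)) X"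
    and R: "\<And>Y Y'. repl A D Y Y' \<Longrightarrow> repl A D G\<langle>Y\<rangle> G'\<langle>Y'\<rangle>"
    using repl_fillD[OF ImpL.prems] by blast
  from T(2) obtain E' Y where X: "X = (E' ;; Y)" "repl A D E E'" "repl A D (Fm (a1 \<rightarrow>\<^sub>f a2)) Y"
    by (auto simp: repl_simps(2))
  \<comment> \<open>When the implication itself is replaced, \<open>Y\<close> is \<open>D\<close>
    and the clause of \<open>left_adm\<close> is used with \<open>S\<close> instantiated by
    \<open>E'\<close>.\<close>
  from ImpL.hyps(2)[OF X(2)] ImpL.hyps(4)[OF R[OF repl_refl]] show ?case
    using T(1) X(1,3) assms(2) by (auto simp: repl_simps(1) intro: gwikt.ImpL)
next
  case (ImpR b1 b2)
  then show ?case by (auto simp: repl_simps intro!: gwikt.ImpR intro: repl.intros)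
next
  case (DiaL G a b)
  obtain G' X where T: "T = G'\<langle>X\<rangle>" "repl A D (Fm (Dia a)) X"
    and R: "\<And>Y Y'. repl A D Y Y' \<Longrightarrow> repl A D G\<langle>Y\<rangle> G'\<langle>Y'\<rangle>"
    using repl_fillD[OF DiaL.prems] by blast
  from DiaL.hyps(2)[OF R[OF repl_refl]] show ?case
    using T assms(2) by (auto simp: repl_simps intro: gwikt.DiaL)
next
  case (DiaR S b)
  then show ?case by (auto simp: repl_simps intro!: gwikt.DiaR intro: repl.intros)
next
  case (PstL G a b)
  obtain G' X where T: "T = G'\<langle>X\<rangle>" "repl A D (Fm (Pst a)) X"
    and R: "\<And>Y Y'. repl A D Y Y' \<Longrightarrow> repl A D G\<langle>Y\<rangle> G'\<langle>Y'\<rangle>"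
    using repl_fillD[OF PstL.prems] by blast
  from PstL.hyps(2)[OF R[OF repl_refl]] show ?case
    using T assms(2) by (auto simp: repl_simps intro: gwikt.PstL)
next
  case (PstR S b)
  then show ?case by (auto simp: repl_simps intro!: gwikt.PstR intro: repl.intros)
next
  case (BBoxL G a b)
  obtain G' X where T: "T = G'\<langle>X\<rangle>" "repl A D (Circ (Fm (BBox a))) X"
    and R: "\<And>Y Y'. repl A D Y Y' \<Longrightarrow> repl A D G\<langle>Y\<rangle> G'\<langle>Y'\<rangle>"
    using repl_fillD[OF BBoxL.prems] by blast
  from BBoxL.hyps(2)[OF R[OF repl_refl]] show ?case
    using T assms(2) by (auto simp: repl_simps intro: gwikt.BBoxL)
next
  case (BBoxR b)
  then show ?case by (auto simp: repl_simps intro!: gwikt.BBoxR intro: repl.intros)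
next
  case (BoxL G a b)
  obtain G' X where T: "T = G'\<langle>X\<rangle>" "repl A D (Bullet (Fm (Box a))) X"
    and R: "\<And>Y Y'. repl A D Y Y' \<Longrightarrow> repl A D G\<langle>Y\<rangle> G'\<langle>Y'\<rangle>"
    using repl_fillD[OF BoxL.prems] by blast
  from BoxL.hyps(2)[OF R[OF repl_refl]] show ?case
    using T assms(2) by (auto simp: repl_simps intro: gwikt.BoxL)
next
  case (BoxR b)
  then show ?case by (auto simp: repl_simps intro!: gwikt.BoxR intro: repl.intros)
next
  case (ConCirc G D1 D2 b)
  obtain G' X where T: "T = G'\<langle>X\<rangle>" "repl A D (Circ (D1 ;; D2)) X"
    and R: "\<And>Y Y'. repl A D Y Y' \<Longrightarrow> repl A D G\<langle>Y\<rangle> G'\<langle>Y'\<rangle>"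
    using repl_fillD[OF ConCirc.prems] by blast
  from T(2) obtain D1' D2' where X: "X = (Circ (D1' ;; D2'))"
      "repl A D D1 D1'" "repl A D D2 D2'"
    by (auto simp: repl_simps(2-4))
  then have "repl A D (Circ D1 ;; Circ D2) (Circ D1' ;; Circ D2')"
    by (auto intro: repl.intros)
  from ConCirc.hyps(2)[OF R[OF this]] show ?case
    unfolding T(1) X(1) by (rule gwikt.ConCirc)
next
  case (ConBullet G D1 D2 b)
  obtain G' X where T: "T = G'\<langle>X\<rangle>" "repl A D (Bullet (D1 ;; D2)) X"
    and R: "\<And>Y Y'. repl A D Y Y' \<Longrightarrow> repl A D G\<langle>Y\<rangle> G'\<langle>Y'\<rangle>"
    using repl_fillD[OF ConBullet.prems] by blast
  from T(2) obtain D1' D2' where X: "X = (Bullet (D1' ;; D2'))"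
      "repl A D D1 D1'" "repl A D D2 D2'"
    by (auto simp: repl_simps(2-4))
  then have "repl A D (Bullet D1 ;; Bullet D2) (Bullet D1' ;; Bullet D2')"
    by (auto intro: repl.intros)
  from ConBullet.hyps(2)[OF R[OF this]] show ?case
    unfolding T(1) X(1) by (rule gwikt.ConBullet)
next
  case (ConA x G b)
  obtain G' X where T: "T = G'\<langle>X\<rangle>" "repl A D (Fm x) X"
    and R: "\<And>Y Y'. repl A D Y Y' \<Longrightarrow> repl A D G\<langle>Y\<rangle> G'\<langle>Y'\<rangle>"
    using repl_fillD[OF ConA.prems] by blast
  \<comment> \<open>Both copies in the premise share the fate of the contracted formula, so what is
    left is either \<open>ConA\<close> or contraction of \<open>D\<close>.\<close>
  from ConA.hyps(3)[OF R[OF repl.Comma[OF T(2) T(2)]]] show ?case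
    using T ConA.hyps(1) assms(2)
    by (auto simp: repl_simps intro: gwikt.ConA contractibleD left_adm_contractible)
next
  case (ConSharp sharp G a b)
  obtain G' X where T: "T = G'\<langle>X\<rangle>" "repl A D (Fm (sharp a)) X"
    and R: "\<And>Y Y'. repl A D Y Y' \<Longrightarrow> repl A D G\<langle>Y\<rangle> G'\<langle>Y'\<rangle>"
    using repl_fillD[OF ConSharp.prems] by blast
  from ConSharp.hyps(3)[OF R[OF repl.Comma[OF T(2) T(2)]]] show ?case
    using T ConSharp.hyps(1) assms(2)
    by (auto simp: repl_simps intro: gwikt.ConSharp contractibleD left_adm_contractible)
next
  case (ConImp G a1 a2 b)
  obtain G' X where T: "T = G'\<langle>X\<rangle>" "repl A D (Fm (a1 \<rightarrow>\<^sub>f a2)) X"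
    and R: "\<And>Y Y'. repl A D Y Y' \<Longrightarrow> repl A D G\<langle>Y\<rangle> G'\<langle>Y'\<rangle>"
    using repl_fillD[OF ConImp.prems] by blast
  from ConImp.hyps(2)[OF R[OF repl.Comma[OF T(2) T(2)]]] show ?case
    using T ConImp.hyps(1) assms(2)
    by (auto simp: repl_simps intro: gwikt.ConImp contractibleD left_adm_contractible)
next
  case (Wk1 G D1 b D2)
  obtain G' X where T: "T = G'\<langle>X\<rangle>" "repl A D (D1 ;; D2) X"
    and R: "\<And>Y Y'. repl A D Y Y' \<Longrightarrow> repl A D G\<langle>Y\<rangle> G'\<langle>Y'\<rangle>"
    using repl_fillD[OF Wk1.prems] by blast
  from T(2) obtain D1' D2' where X: "X = (D1' ;; D2')"
      "repl A D D1 D1'" "repl A D D2 D2'"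
    by (auto simp: repl_simps(2-4))
  then have "repl A D (D1) (D1')"
    by (auto intro: repl.intros)
  from Wk1.hyps(2)[OF R[OF this]] show ?case
    unfolding T(1) X(1) by (rule gwikt.Wk1)
next
  case (Wk2 G D2 b D1)
  obtain G' X where T: "T = G'\<langle>X\<rangle>" "repl A D (D1 ;; D2) X"
    and R: "\<And>Y Y'. repl A D Y Y' \<Longrightarrow> repl A D G\<langle>Y\<rangle> G'\<langle>Y'\<rangle>"
    using repl_fillD[OF Wk2.prems] by blast
  from T(2) obtain D1' D2' where X: "X = (D1' ;; D2')"
      "repl A D D1 D1'" "repl A D D2 D2'"
    by (auto simp: repl_simps(2-4))
  then have "repl A D (D2) (D2')"
    by (auto intro: repl.intros)
  from Wk2.hyps(2)[OF R[OF this]] show ?case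
    unfolding T(1) X(1) by (rule gwikt.Wk2)
next
  case (Ex G D1 D2 b)
  obtain G' X where T: "T = G'\<langle>X\<rangle>" "repl A D (D2 ;; D1) X"
    and R: "\<And>Y Y'. repl A D Y Y' \<Longrightarrow> repl A D G\<langle>Y\<rangle> G'\<langle>Y'\<rangle>"
    using repl_fillD[OF Ex.prems] by blast
  from T(2) obtain D1' D2' where X: "X = (D2' ;; D1')"
      "repl A D D1 D1'" "repl A D D2 D2'"
    by (auto simp: repl_simps(2-4))
  then have "repl A D (D1 ;; D2) (D1' ;; D2')"
    by (auto intro: repl.intros)
  from Ex.hyps(2)[OF R[OF this]] show ?case
    unfolding T(1) X(1) by (rule gwikt.Ex)
next
  case (DualCircBullet D1 D2 G b)
  obtain G' X where T: "T = G'\<langle>X\<rangle>" "repl A D (D1 ;; Bullet D2) X"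
    and R: "\<And>Y Y'. repl A D Y Y' \<Longrightarrow> repl A D G\<langle>Y\<rangle> G'\<langle>Y'\<rangle>"
    using repl_fillD[OF DualCircBullet.prems] by blast
  from T(2) obtain D1' D2' where X: "X = (D1' ;; Bullet D2')"
      "repl A D D1 D1'" "repl A D D2 D2'"
    by (auto simp: repl_simps(2-4))
  then have "repl A D (Circ D1 ;; D2) (Circ D1' ;; D2')"
    by (auto intro: repl.intros)
  from DualCircBullet.hyps(2)[OF this] show ?case
    unfolding T(1) X(1) by (rule gwikt.DualCircBullet)
next
  case (DualBulletCirc D1 D2 G b)
  obtain G' X where T: "T = G'\<langle>X\<rangle>" "repl A D (D1 ;; Circ D2) X"
    and R: "\<And>Y Y'. repl A D Y Y' \<Longrightarrow> repl A D G\<langle>Y\<rangle> G'\<langle>Y'\<rangle>"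
    using repl_fillD[OF DualBulletCirc.prems] by blast
  from T(2) obtain D1' D2' where X: "X = (D1' ;; Circ D2')"
      "repl A D D1 D1'" "repl A D D2 D2'"
    by (auto simp: repl_simps(2-4))
  then have "repl A D (Bullet D1 ;; D2) (Bullet D1' ;; D2')"
    by (auto intro: repl.intros)
  from DualBulletCirc.hyps(2)[OF this] show ?case
    unfolding T(1) X(1) by (rule gwikt.DualBulletCirc)
next
  case (AssocL G D1 D2 D3 b)
  obtain G' X where T: "T = G'\<langle>X\<rangle>" "repl A D ((D1 ;; D2) ;; D3) X"
    and R: "\<And>Y Y'. repl A D Y Y' \<Longrightarrow> repl A D G\<langle>Y\<rangle> G'\<langle>Y'\<rangle>"
    using repl_fillD[OF AssocL.prems] by blast
  from T(2) obtain D1' D2' D3' where X: "X = ((D1' ;; D2') ;; D3')"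
      "repl A D D1 D1'" "repl A D D2 D2'" "repl A D D3 D3'"
    by (auto simp: repl_simps(2-4))
  then have "repl A D (D1 ;; (D2 ;; D3)) (D1' ;; (D2' ;; D3'))"
    by (auto intro: repl.intros)
  from AssocL.hyps(2)[OF R[OF this]] show ?case
    unfolding T(1) X(1) by (rule gwikt.AssocL)
next
  case (AssocR G D1 D2 D3 b)
  obtain G' X where T: "T = G'\<langle>X\<rangle>" "repl A D (D1 ;; (D2 ;; D3)) X"
    and R: "\<And>Y Y'. repl A D Y Y' \<Longrightarrow> repl A D G\<langle>Y\<rangle> G'\<langle>Y'\<rangle>"
    using repl_fillD[OF AssocR.prems] by blast
  from T(2) obtain D1' D2' D3' where X: "X = (D1' ;; (D2' ;; D3'))"
      "repl A D D1 D1'" "repl A D D2 D2'" "repl A D D3 D3'"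
    by (auto simp: repl_simps(2-4))
  then have "repl A D ((D1 ;; D2) ;; D3) ((D1' ;; D2') ;; D3')"
    by (auto intro: repl.intros)
  from AssocR.hyps(2)[OF R[OF this]] show ?case
    unfolding T(1) X(1) by (rule gwikt.AssocR)
qed auto

section \<open>Replacing the succedent\<close>

text \<open>The dual notion: the right rules whose principal formula is \<open>A\<close> remain admissible when
  their conclusion \<open>S \<Rightarrow> A\<close> is replaced by \<open>K\<langle>S\<rangle> \<Rightarrow> b\<close>.\<close>

primrec right_adm :: "fml \<Rightarrow> ctx \<Rightarrow> fml \<Rightarrow> bool" where
  "right_adm (Var n) K b \<longleftrightarrow> K\<langle>Fm (Var n)\<rangle> \<turnstile> b"
| "right_adm Top K b \<longleftrightarrow> K\<langle>Fm Top\<rangle> \<turnstile> b"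
| "right_adm Bot K b \<longleftrightarrow> K\<langle>Fm Bot\<rangle> \<turnstile> b"
| "right_adm (a1 \<rightarrow>\<^sub>f a2) K b \<longleftrightarrow> (\<forall>S. Fm a1 ;; S \<turnstile> a2 \<longrightarrow> K\<langle>S\<rangle> \<turnstile> b)"
| "right_adm (a1 \<and>\<^sub>f a2) K b \<longleftrightarrow> (\<forall>S. S \<turnstile> a1 \<longrightarrow> S \<turnstile> a2 \<longrightarrow> K\<langle>S\<rangle> \<turnstile> b)"
| "right_adm (a1 \<or>\<^sub>f a2) K b \<longleftrightarrow> (\<forall>S. S \<turnstile> a1 \<or> S \<turnstile> a2 \<longrightarrow> K\<langle>S\<rangle> \<turnstile> b)"
| "right_adm (Dia a) K b \<longleftrightarrow> (\<forall>S. S \<turnstile> a \<longrightarrow> K\<langle>Circ S\<rangle> \<turnstile> b)"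
| "right_adm (Box a) K b \<longleftrightarrow> (\<forall>S. Bullet S \<turnstile> a \<longrightarrow> K\<langle>S\<rangle> \<turnstile> b)"
| "right_adm (Pst a) K b \<longleftrightarrow> (\<forall>S. S \<turnstile> a \<longrightarrow> K\<langle>Bullet S\<rangle> \<turnstile> b)"
| "right_adm (BBox a) K b \<longleftrightarrow> (\<forall>S. Circ S \<turnstile> a \<longrightarrow> K\<langle>S\<rangle> \<turnstile> b)"

text \<open>Induction on the derivation. Rules acting on the antecedent are repeated inside
  \<open>K\<close>, with the composite context \<open>K \<cdot> G\<close>; right rules are exactly
  what \<open>right_adm\<close> covers, and \<open>IdA\<close> is its atomic clauses. No further
  induction on \<open>A\<close> is involved.\<close>

lemma fill_right_adm:
  assumes "S \<turnstile> A" "right_adm A K b"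
  shows "K\<langle>S\<rangle> \<turnstile> b"
  using assms
proof (induction "Some S" A arbitrary: S rule: gwikt.induct)
  case (IdA x)
  then show ?case by (auto simp: Atom_def)
qed (auto simp flip: fill_ctx_comp intro: gwikt.intros)

lemma fill_left_adm: "G\<langle>Fm A\<rangle> \<turnstile> b \<Longrightarrow> left_adm A D \<Longrightarrow> G\<langle>D\<rangle> \<turnstile> b"
  by (rule replace_left_adm) (auto intro: repl_fill repl.replace)

text \<open>Serves to invert a left rule at both copies of a formula that is to be
  contracted.\<close>

lemma fill_left_adm2:
  "G\<langle>Fm A ;; Fm A\<rangle> \<turnstile> b \<Longrightarrow> left_adm A D \<Longrightarrow> G\<langle>D ;; D\<rangle> \<turnstile> b"
  by (rule replace_left_adm) (auto intro: repl_fill repl.intros)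

section \<open>Contraction of arbitrary structures\<close>

text \<open>Regrouping and exchange bring the copies of \<open>S\<close> together and the copies of
  \<open>T\<close> together; each pair is then contracted in place.\<close>

lemma contractible_Comma:
  assumes "contractible S" "contractible T"
  shows "contractible (S ;; T)"
  unfolding contractible_def
proof (intro allI impI)
  fix G b
  assume "G\<langle>(S ;; T) ;; (S ;; T)\<rangle> \<turnstile> b"
  then have "G\<langle>S ;; (T ;; (S ;; T))\<rangle> \<turnstile> b" by (rule gwikt.AssocR)
  then have "G\<langle>S ;; ((S ;; T) ;; T)\<rangle> \<turnstile> b"
    using gwikt.Ex[of _ "G \<cdot> CommaR S Hole"] by (simp add: fill_ctx_comp)
  then have "G\<langle>S ;; (S ;; (T ;; T))\<rangle> \<turnstile> b"
    using gwikt.AssocR[of _ "G \<cdot> CommaR S Hole"] by (simp add: fill_ctx_comp)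
  then have "G\<langle>(S ;; S) ;; (T ;; T)\<rangle> \<turnstile> b" by (rule gwikt.AssocL)
  then have "G\<langle>S ;; (T ;; T)\<rangle> \<turnstile> b"
    using contractibleD[OF assms(1), of "G \<cdot> CommaL Hole (T ;; T)"] by (simp add: fill_ctx_comp)
  then show "G\<langle>S ;; T\<rangle> \<turnstile> b"
    using contractibleD[OF assms(2), of "G \<cdot> CommaR S Hole"] by (simp add: fill_ctx_comp)
qed

lemma contractible_Circ:
  assumes "contractible S"
  shows "contractible (Circ S)"
  unfolding contractible_def
proof (intro allI impI)
  fix G b
  assume "G\<langle>Circ S ;; Circ S\<rangle> \<turnstile> b"
  then have "G\<langle>Circ (S ;; S)\<rangle> \<turnstile> b" by (rule gwikt.ConCirc)
  then show "G\<langle>Circ S\<rangle> \<turnstile> b"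
    using contractibleD[OF assms, of "G \<cdot> CircC Hole"] by (simp add: fill_ctx_comp)
qed

lemma contractible_Bullet:
  assumes "contractible S"
  shows "contractible (Bullet S)"
  unfolding contractible_def
proof (intro allI impI)
  fix G b
  assume "G\<langle>Bullet S ;; Bullet S\<rangle> \<turnstile> b"
  then have "G\<langle>Bullet (S ;; S)\<rangle> \<turnstile> b" by (rule gwikt.ConBullet)
  then show "G\<langle>Bullet S\<rangle> \<turnstile> b"
    using contractibleD[OF assms, of "G \<cdot> BulletC Hole"] by (simp add: fill_ctx_comp)
qed

text \<open>Atoms, implications and both boxes have primitive contraction rules. Any other formula
  is inverted at both copies, its structural reading is contracted by induction, and the left rule
  restores it. For a disjunction it suffices that both copies take the same disjunct.\<close>

lemma contractible_Fm: "contractible (Fm A)"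
proof (induction A)
  case (And a1 a2)
  have "left_adm (a1 \<and>\<^sub>f a2) (Fm a1 ;; Fm a2)" by simp
  from fill_left_adm2[OF _ this] contractible_Comma[OF And] show ?case
    by (auto simp: contractible_def intro: gwikt.AndL)
next
  case (Or a1 a2)
  have "left_adm (a1 \<or>\<^sub>f a2) (Fm a1)" "left_adm (a1 \<or>\<^sub>f a2) (Fm a2)" by simp_all
  from fill_left_adm2[OF _ this(1)] fill_left_adm2[OF _ this(2)] Or show ?case
    by (auto simp: contractible_def intro: gwikt.OrL)
next
  case (Dia a)
  have "left_adm (Dia a) (Circ (Fm a))" by simp
  from fill_left_adm2[OF _ this] contractible_Circ[OF Dia] show ?case
    by (auto simp: contractible_def intro: gwikt.DiaL)
next
  case (Pst a)
  have "left_adm (Pst a) (Bullet (Fm a))" by simp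
  from fill_left_adm2[OF _ this] contractible_Bullet[OF Pst] show ?case
    by (auto simp: contractible_def intro: gwikt.PstL)
qed (auto simp: contractible_def Atom_def intro: gwikt.ConA gwikt.ConSharp gwikt.ConImp)

lemma contractible: "contractible D"
  by (induction D) (auto intro: contractible_Fm contractible_Comma contractible_Circ contractible_Bullet)

section \<open>Admissibility of the cut-like rules\<close>

text \<open>For implications and boxes the right rule is invertible, which exposes a derivation to
  cut with. For the other compound formulas the goal context itself is used as \<open>K\<close> in
  \<open>fill_right_adm\<close>, reducing the claim to the case where
  \<open>D \<turnstile> A\<close> ends in the right rule for \<open>A\<close>. The induction
  hypotheses then act as cuts on subformulas.\<close>

lemma left_adm_if_derivable: "D \<turnstile> A \<Longrightarrow> left_adm A D"
proof (induction A arbitrary: D)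
  case (Imp a1 a2)
  \<comment> \<open>With this context and succedent, \<open>right_adm\<close> becomes a tautology
    and \<open>fill_right_adm\<close> yields inversion of \<open>ImpR\<close>.\<close>
  have "right_adm (a1 \<rightarrow>\<^sub>f a2) (CommaR (Fm a1) Hole) a2" by simp
  from fill_right_adm[OF Imp.prems this] have D: "Fm a1 ;; D \<turnstile> a2" by simp
  have "G\<langle>S ;; D\<rangle> \<turnstile> b" if "S \<turnstile> a1" "G\<langle>Fm a2\<rangle> \<turnstile> b" for S G b
  proof -
    \<comment> \<open>Cut on \<open>a1\<close> against the inverted premise; the cut on
      \<open>a2\<close> follows.\<close>
    have "S ;; D \<turnstile> a2"
      using fill_left_adm[of "CommaL Hole D", OF _ Imp.IH(1)[OF that(1)]] D by simp
    from fill_left_adm[OF that(2) Imp.IH(2)[OF this]] show ?thesis .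
  qed
  then show ?case by (simp add: contractible)
next
  case (And a1 a2)
  have "right_adm (a1 \<and>\<^sub>f a2) G b" if "G\<langle>Fm a1 ;; Fm a2\<rangle> \<turnstile> b" for G b
  proof -
    have "G\<langle>S\<rangle> \<turnstile> b" if S: "S \<turnstile> a1" "S \<turnstile> a2" for S
    proof -
      have "G\<langle>S ;; Fm a2\<rangle> \<turnstile> b"
        using fill_left_adm[of "G \<cdot> CommaL Hole (Fm a2)", OF _ And.IH(1)[OF S(1)]]
          \<open>G\<langle>Fm a1 ;; Fm a2\<rangle> \<turnstile> b\<close> by (simp add: fill_ctx_comp)
      then have "G\<langle>S ;; S\<rangle> \<turnstile> b"
        using fill_left_adm[of "G \<cdot> CommaR S Hole", OF _ And.IH(2)[OF S(2)]]
        by (simp add: fill_ctx_comp)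
      \<comment> \<open>Cutting on both conjuncts has duplicated their common antecedent
        \<open>S\<close>.\<close>
      then show ?thesis by (rule contractibleD[OF contractible])
    qed
    then show ?thesis by simp
  qed
  then show ?case
    unfolding left_adm.simps by (intro allI impI fill_right_adm[OF And.prems])
next
  case (Or a1 a2)
  have "right_adm (a1 \<or>\<^sub>f a2) G b" if "G\<langle>Fm a1\<rangle> \<turnstile> b" "G\<langle>Fm a2\<rangle> \<turnstile> b" for G b
    using that Or.IH fill_left_adm by auto
  then show ?case
    unfolding left_adm.simps by (intro allI impI fill_right_adm[OF Or.prems])
next
  case (Dia a)
  have "right_adm (Dia a) G b" if "G\<langle>Circ (Fm a)\<rangle> \<turnstile> b" for G b
    using that fill_left_adm[of "G \<cdot> CircC Hole", OF _ Dia.IH] by (simp add: fill_ctx_comp)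
  then show ?case
    unfolding left_adm.simps by (intro allI impI fill_right_adm[OF Dia.prems])
next
  case (Pst a)
  have "right_adm (Pst a) G b" if "G\<langle>Bullet (Fm a)\<rangle> \<turnstile> b" for G b
    using that fill_left_adm[of "G \<cdot> BulletC Hole", OF _ Pst.IH] by (simp add: fill_ctx_comp)
  then show ?case
    unfolding left_adm.simps by (intro allI impI fill_right_adm[OF Pst.prems])
next
  case (Box a)
  \<comment> \<open>As for implication, this choice of context gives inversion of
    \<open>BoxR\<close>.\<close>
  have "right_adm (Box a) (BulletC Hole) a" by simp
  from fill_right_adm[OF Box.prems this] have "Bullet D \<turnstile> a" by simp
  from fill_left_adm[OF _ Box.IH[OF this]] show ?case by (simp add: contractible)
next
  case (BBox a)
  have "right_adm (BBox a) (CircC Hole) a" by simp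
  from fill_right_adm[OF BBox.prems this] have "Circ D \<turnstile> a" by simp
  from fill_left_adm[OF _ BBox.IH[OF this]] show ?case by (simp add: contractible)
qed (simp_all add: contractible)

lemma mix_admissible: "D \<turnstile> A \<Longrightarrow> mfill M (Fm A) \<turnstile> b \<Longrightarrow> mfill M D \<turnstile> b"
  by (blast intro: replace_left_adm left_adm_if_derivable repl_mfill)

lemma cut_admissible: "D \<turnstile> A \<Longrightarrow> G\<langle>Fm A\<rangle> \<turnstile> b \<Longrightarrow> G\<langle>D\<rangle> \<turnstile> b"
  by (blast intro: fill_left_adm left_adm_if_derivable)

text \<open>By induction the premises of a cut-like rule are already free of such rules, so the
  uppermost instances go first and admissibility replaces each one.\<close>

lemma cut_elimination: "gwikt R S b \<Longrightarrow> gwikt {} S b"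
  by (induction rule: gwikt.induct) (blast intro: gwikt.intros mix_admissible cut_admissible)+

theorem theorem1:
  fixes G :: ctx and D :: fstruct and b :: fml
  assumes "gwikt UNIV (Some (G\<langle>D\<rangle>)) b"
  shows "gwikt {} (Some (G\<langle>D\<rangle>)) b"
  using assms by (rule cut_elimination)

end
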